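(* Define $\mathbf{U}=(U_{(i)})_{i=0}^{n+1}$ with components $U_{(i)}:=F_o(X_{(i)})$, where $F_o$ is the distribution function corresponding to the density $f_{0,n+1}$. Then $U_{(1)},\ldots,U_{(n)}$ are distributed as the order statistics of $n$ independent random variables having uniform distribution on $[0,1]$, while $U_{(0)}=0$ and $U_{(n+1)}=1$. Moreover, for arbitrary integers $0\le j<k\le n+1$ with $k-j>1$, $$T_{jk}(\mathbf{X})\begin{cases}\ge T_{jk}(\mathbf{U}), & \text{if } f \text{ is nondecreasing on } \mathcal{I}_{jk},\\ \le T_{jk}(\mathbf{U}), & \text{if } f \text{ is nonincreasing on } \mathcal{I}_{jk}.\end{cases}$$
   Context: Data: $Y_1,\ldots,Y_m$ are independent random variables with common distribution function $F$ and Lebesgue density $f$ on $\mathbb{R}$, with order statistics $Y_{(1)}<\cdots<Y_{(m)}$ (a.s.). If $F$ is known to be supported by $[a,\infty)$, $(-\infty,b]$ or $[a,b]$ ($-\infty<a<b<\infty$), one adds the point $Y_{(0)}:=a$, the point $Y_{(m+1)}:=b$, or both, respectively, to the ordered sample. The resulting ordered vector is relabelled $\mathbf{X}=(X_{(i)})_{i=0}^{n+1}$ with $X_{(0)}<X_{(1)}<\cdots<X_{(n+1)}$, so $n\in\{m-2,m-1,m\}$. For $0\le j<k\le n+1$ let $\mathcal{I}_{jk}:=(X_{(j)},X_{(k)})$ and $$f_{jk}(x):=\frac{1\{x\in\mathcal{I}_{jk}\}f(x)}{F(X_{(k)})-F(X_{(j)})}.$$ Let $\beta(x):=1\{x\in(0,1)\}(2x-1)$.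 For a vector $\mathbf{V}=(V_{(i)})_{i=0}^{n+1}$ with strictly increasing components and $k-j>1$, $$T_{jk}(\mathbf{V}):=\sum_{i=j+1}^{k-1}\beta\left(\frac{V_{(i)}-V_{(j)}}{V_{(k)}-V_{(j)}}\right).$$ *)

theory Defs
  imports "HOL-Probability.Probability"
begin

text \<open>An optional known left endpoint \<open>lo\<close> and right endpoint \<open>up\<close> encode the four cases: no
  restriction, support in \<open>[a,\<infinity>)\<close>, in \<open>(-\<infinity>,b]\<close>, or in \<open>[a,b]\<close>.\<close>

definition support_region :: "real option \<Rightarrow> real option \<Rightarrow> real set" where
  "support_region lo up =
     {x. (\<forall>a. lo = Some a \<longrightarrow> a \<le> x) \<and> (\<forall>b. up = Some b \<longrightarrow> x \<le> b)}"

text \<open>Samples are indexed \<open>y 1, \<dots>, y m\<close>; \<open>order_stat m y i\<close> is meant for \<open>1 \<le> i \<le> m\<close>.\<close>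

definition order_stat :: "nat \<Rightarrow> (nat \<Rightarrow> real) \<Rightarrow> nat \<Rightarrow> real" where
  "order_stat m y i = sort (map y [1..<Suc m]) ! (i - 1)"

text \<open>The relabelled vector \<open>X\<^sub>(\<^sub>0\<^sub>), \<dots>, X\<^sub>(\<^sub>n\<^sub>+\<^sub>1\<^sub>)\<close>: the ordered sample together with the known
  endpoints, indexed from 0.\<close>

definition extended_order_stat ::
  "real option \<Rightarrow> real option \<Rightarrow> nat \<Rightarrow> (nat \<Rightarrow> real) \<Rightarrow> nat \<Rightarrow> real" where
  "extended_order_stat lo up m y i =
     ((case lo of None \<Rightarrow> [] | Some a \<Rightarrow> [a])
      @ map (order_stat m y) [1..<Suc m]
      @ (case up of None \<Rightarrow> [] | Some b \<Rightarrow> [b])) ! i"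

definition local_density ::
  "(real \<Rightarrow> real) \<Rightarrow> (real \<Rightarrow> real) \<Rightarrow> (nat \<Rightarrow> real) \<Rightarrow> nat \<Rightarrow> nat \<Rightarrow> real \<Rightarrow> real" where
  "local_density F f V j k x =
     indicator {V j<..<V k} x * f x / (F (V k) - F (V j))"

definition local_cdf ::
  "(real \<Rightarrow> real) \<Rightarrow> (real \<Rightarrow> real) \<Rightarrow> (nat \<Rightarrow> real) \<Rightarrow> nat \<Rightarrow> nat \<Rightarrow> real \<Rightarrow> real" where
  "local_cdf F f V j k =
     cdf (density lborel (\<lambda>x. ennreal (local_density F f V j k x)))"

definition beta_weight :: "real \<Rightarrow> real" where
  "beta_weight x = indicator {0<..<1} x * (2 * x - 1)"

definition T_stat :: "nat \<Rightarrow> nat \<Rightarrow> (nat \<Rightarrow> real) \<Rightarrow> real" where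
  "T_stat j k V = (\<Sum>i = j + 1..k - 1. beta_weight ((V i - V j) / (V k - V j)))"

end

theory Submission
  imports Defs
begin

text \<open>
  The statement has a probabilistic and a deterministic half, and \<open>F\<close> mediates between them. Write
  \<open>V\<^sub>(\<^sub>1\<^sub>), \<dots>, V\<^sub>(\<^sub>m\<^sub>)\<close> for the order statistics of \<open>F(Y\<^sub>1), \<dots>, F(Y\<^sub>m)\<close>. Since \<open>F\<close> is continuous, the
  \<open>F(Y\<^sub>i)\<close> are independent and uniform on \<open>[0,1]\<close>; since \<open>F\<close> is nondecreasing, it commutes with
  sorting. As \<open>F\<close> takes the known endpoints to 0 and 1, the vector \<open>F(X\<^sub>(\<^sub>i\<^sub>))\<close> is \<open>V\<close> with a 0
  prepended if the left endpoint is known and a 1 appended if the right one is. It is almost surely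
  strictly increasing, hence so is \<open>X\<close>, and
  \<open>U\<^sub>(\<^sub>i\<^sub>) = (F(X\<^sub>(\<^sub>i\<^sub>)) - F(X\<^sub>(\<^sub>0\<^sub>))) / (F(X\<^sub>(\<^sub>n\<^sub>+\<^sub>1\<^sub>)) - F(X\<^sub>(\<^sub>0\<^sub>)))\<close> (\<open>local_cdf_eq\<close>).

  The law of \<open>U\<close> thus becomes a question about uniform order statistics alone: those that are not
  extremes used for the normalisation, rescaled affinely so that the normalising endpoints become 0
  and 1, should again be uniform order statistics (\<open>distr_spacing_ratios_ord_unif\<close>). If both endpoints
  are known there is nothing to rescale. If only the left one is known, one divides by the maximum:
  given that the maximum is \<open>w\<close> and is attained at index \<open>k\<close>, the other variables are independent and
  uniform on \<open>[0,w]\<close>, so dividing them by \<open>w\<close> gives uniform variables whatever \<open>w\<close> and \<open>k\<close> are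
  (\<open>ord_unif_max\<close>). The case of the minimum follows by the reflection \<open>u \<mapsto> 1 - u\<close>
  (\<open>ord_unif_min\<close>), and when neither endpoint is known one removes first the maximum, then the minimum.

  The inequality is deterministic. The affine normalisation cancels in the ratios that enter
  \<open>T\<^sub>j\<^sub>k(U)\<close>, which are therefore \<open>(F(x) - F(a)) / (F(b) - F(a))\<close> with \<open>a = X\<^sub>(\<^sub>j\<^sub>)\<close>, \<open>x = X\<^sub>(\<^sub>i\<^sub>)\<close>, \<open>b = X\<^sub>(\<^sub>k\<^sub>)\<close>. If
  \<open>f\<close> is nondecreasing on \<open>(a,b)\<close>, then \<open>F\<close> is convex there and lies below its chord, so the ratio is
  at most \<open>(x - a) / (b - a)\<close>; if \<open>f\<close> is nonincreasing, the reverse holds. The weight \<open>\<beta>\<close> is increasing on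
  \<open>(0,1)\<close>, so the comparison passes to the sums (\<open>T_stat_comparison\<close>).
\<close>

section \<open>Order statistics of a finite family\<close>

text \<open>Order statistics are taken over an arbitrary finite index set: deleting the index of an extreme value
  leaves an index set that is no longer an initial segment of the natural numbers.\<close>

definition ord_values :: "'i set \<Rightarrow> ('i \<Rightarrow> real) \<Rightarrow> real list" where
  "ord_values I u = sorted_list_of_multiset (image_mset u (mset_set I))"

text \<open>The components are numbered from 1, and the function is \<open>undefined\<close> elsewhere, so that it is a point
  of the product space over \<open>{1..card I}\<close>.\<close>

definition ord_vec :: "'i set \<Rightarrow> ('i \<Rightarrow> real) \<Rightarrow> nat \<Rightarrow> real" where
  "ord_vec I u = (\<lambda>i\<in>{1..card I}. ord_values I u ! (i - 1))"

lemma ord_values_eqI: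
  assumes "sorted xs" "mset xs = image_mset u (mset_set I)"
  shows "ord_values I u = xs"
  unfolding ord_values_def assms(2)[symmetric] using assms(1) by (simp add: sorted_sort_id)

lemma sorted_ord_values [simp]: "sorted (ord_values I u)"
  by (simp add: ord_values_def)

lemma mset_ord_values [simp]: "mset (ord_values I u) = image_mset u (mset_set I)"
  by (simp add: ord_values_def)

lemma length_ord_values [simp]: "length (ord_values I u) = card I"
  by (metis mset_ord_values size_image_mset size_mset size_mset_set)

lemma set_ord_values [simp]: "finite I \<Longrightarrow> set (ord_values I u) = u ` I"
  by (metis mset_ord_values set_mset_mset set_image_mset finite_set_mset_mset_set)

lemma ord_values_cong: "(\<And>i. i \<in> I \<Longrightarrow> u i = v i) \<Longrightarrow> ord_values I u = ord_values I v"
  unfolding ord_values_def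
  by (metis (mono_tags, lifting) image_mset_cong elem_mset_set finite_set_mset_mset_set
      mset_set.infinite ex_in_conv set_mset_empty image_mset_empty)

lemma ord_values_mono:
  assumes "finite I" "mono_on (u ` I) h"
  shows "ord_values I (\<lambda>i. h (u i)) = map h (ord_values I u)"
proof (rule ord_values_eqI)
  show "sorted (map h (ord_values I u))"
    using assms by (auto simp: sorted_map intro!: sorted_wrt_mono_rel[OF _ sorted_ord_values[of I u]]
        dest: mono_onD)
qed (simp add: multiset.map_comp o_def)

lemma ord_values_antimono:
  assumes "finite I" "antimono_on (u ` I) h"
  shows "ord_values I (\<lambda>i. h (u i)) = rev (map h (ord_values I u))"
proof (rule ord_values_eqI)
  have "sorted_wrt (\<ge>) (map h (ord_values I u))"
    using assms by (auto simp: sorted_wrt_map intro!: sorted_wrt_mono_rel[OF _ sorted_ord_values[of I u]]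
        dest: monotone_onD)
  thus "sorted (rev (map h (ord_values I u)))"
    by (simp add: sorted_wrt_rev)
qed (simp add: multiset.map_comp o_def)

lemma ord_values_reindex:
  assumes "bij_betw p I J"
  shows "ord_values I (\<lambda>i. u (p i)) = ord_values J u"
proof (rule ord_values_eqI)
  have "mset_set J = image_mset p (mset_set I)"
    using assms by (metis bij_betw_def image_mset_mset_set)
  thus "mset (ord_values J u) = image_mset (\<lambda>i. u (p i)) (mset_set I)"
    by (simp add: multiset.map_comp o_def)
qed simp

lemma ord_values_insert_max:
  assumes "finite J" "k \<notin> J" "\<And>j. j \<in> J \<Longrightarrow> u j \<le> u k"
  shows "ord_values (insert k J) u = ord_values J u @ [u k]"
  by (rule ord_values_eqI) (use assms in \<open>auto simp: sorted_append\<close>)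

lemma order_stat_eq_ord_values: "order_stat m y i = ord_values {1..m} y ! (i - 1)"
proof -
  have "mset (map y [1..<Suc m]) = image_mset y (mset_set {1..m})"
    by (metis mset_map mset_upt atLeastLessThanSuc_atLeastAtMost)
  hence "ord_values {1..m} y = sort (map y [1..<Suc m])"
    by (intro ord_values_eqI) auto
  thus ?thesis by (simp add: order_stat_def)
qed

lemma sorted_nth_le_iff:
  fixes xs :: "'a :: linorder list"
  assumes "sorted xs" "i < length xs"
  shows "xs ! i \<le> x \<longleftrightarrow> i < length (filter (\<lambda>y. y \<le> x) xs)"
  using assms
proof (induction xs arbitrary: i)
  case (Cons a xs)
  show ?case
  proof (cases "a \<le> x")
    case True
    thus ?thesis using Cons by (cases i) auto
  next
    case False
    hence "filter (\<lambda>y. y \<le> x) (a # xs) = []"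
      using Cons.prems by (auto simp: filter_empty_conv)
    moreover have "a \<le> (a # xs) ! i"
      using Cons.prems by (cases i) auto
    ultimately show ?thesis using False by auto
  qed
qed simp

text \<open>The event that an order statistic is at most \<open>x\<close> depends only on how many observations are at
  most \<open>x\<close>. This count is a finite sum of indicators, which gives measurability of order statistics
  without reference to the sorting algorithm.\<close>

lemma ord_values_nth_le_iff:
  assumes "finite I" "i < card I"
  shows "ord_values I u ! i \<le> x \<longleftrightarrow> i < card {j \<in> I. u j \<le> x}"
proof -
  have "length (filter (\<lambda>y. y \<le> x) (ord_values I u)) =
          size (filter_mset (\<lambda>y. y \<le> x) (mset (ord_values I u)))"
    by (metis mset_filter size_mset)
  also have "\<dots> = card {j \<in> I. u j \<le> x}"
    using assms by (simp add: filter_mset_image_mset)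
  finally show ?thesis
    using sorted_nth_le_iff[of "ord_values I u" i x] assms by simp
qed

lemma measurable_ord_values_nth [measurable]:
  assumes "finite I" "i < card I"
  shows "(\<lambda>u. ord_values I u ! i) \<in> borel_measurable (\<Pi>\<^sub>M j\<in>I. borel)"
proof (rule borel_measurable_iff_le[THEN iffD2], intro allI)
  fix x :: real
  have "card {j \<in> I. u j \<le> x} = (\<Sum>j\<in>I. if u j \<le> x then 1 else 0)" for u :: "'a \<Rightarrow> real"
    using assms by (simp add: sum.If_cases Int_def)
  moreover have "{u \<in> space (\<Pi>\<^sub>M j\<in>I. borel). i < (\<Sum>j\<in>I. if u j \<le> x then (1 :: nat) else 0)}
      \<in> sets (\<Pi>\<^sub>M j\<in>I. (borel :: real measure))"
    by measurable
  ultimately show "{u \<in> space (\<Pi>\<^sub>M j\<in>I. borel). ord_values I u ! i \<le> x}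
      \<in> sets (\<Pi>\<^sub>M j\<in>I. (borel :: real measure))"
    using assms by (simp add: ord_values_nth_le_iff)
qed

lemma measurable_ord_vec:
  assumes "finite I" "card I = n"
  shows "ord_vec I \<in> measurable (\<Pi>\<^sub>M j\<in>I. borel) (\<Pi>\<^sub>M i\<in>{1..n}. borel)"
  unfolding ord_vec_def[abs_def] using assms
  by (auto intro!: measurable_restrict measurable_ord_values_nth)

text \<open>A one-dimensional change of variables \<open>T\<close> with weight \<open>c\<close> and factor \<open>C\<close> lifts to finite powers of a
  measure, by Fubini one coordinate at a time. It is applied to the rescaling of \<open>[0,w)\<close> to the unit
  interval, with \<open>c\<close> the indicator of the values below \<open>w\<close> and \<open>C = w\<close>, and to the reflection \<open>y \<mapsto> 1 - y\<close>.\<close>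

lemma product_nn_integral_substitution:
  fixes c :: "'b \<Rightarrow> ennreal" and T :: "'b \<Rightarrow> 'b"
  assumes N: "sigma_finite_measure N" and I: "finite I"
    and [measurable]: "c \<in> borel_measurable N" "T \<in> measurable N N"
    and subst1: "\<And>h. h \<in> borel_measurable N \<Longrightarrow>
      (\<integral>\<^sup>+y. c y * h (T y) \<partial>N) = C * (\<integral>\<^sup>+y. h y \<partial>N)"
    and g: "g \<in> borel_measurable (\<Pi>\<^sub>M i\<in>I. N)"
  shows "(\<integral>\<^sup>+x. (\<Prod>i\<in>I. c (x i)) * g (\<lambda>i\<in>I. T (x i)) \<partial>(\<Pi>\<^sub>M i\<in>I. N)) =
    C ^ card I * (\<integral>\<^sup>+x. g x \<partial>(\<Pi>\<^sub>M i\<in>I. N))"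
proof -
  interpret sigma_finite_measure N by fact
  interpret P: product_sigma_finite "\<lambda>_. N" by unfold_locales
  show ?thesis using I g
  proof (induction I arbitrary: g)
    case empty
    show ?case by (simp add: PiM_empty nn_integral_count_space_finite)
  next
    case (insert i I)
    note [measurable] = insert.prems
    have upd: "(\<lambda>j\<in>insert i I. T ((x(i := y)) j)) = (\<lambda>j\<in>I. T (x j))(i := T y)" for x y
      using insert.hyps by (auto simp: fun_eq_iff)
    have pr: "(\<Prod>j\<in>insert i I. c ((x(i := y)) j)) = c y * (\<Prod>j\<in>I. c (x j))" for x y
    proof -
      have "(\<Prod>j\<in>I. c ((x(i := y)) j)) = (\<Prod>j\<in>I. c (x j))"
        using insert.hyps by (intro prod.cong) auto
      thus ?thesis using insert.hyps by simp
    qed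
    let ?g = "\<lambda>x. \<integral>\<^sup>+y. g (x(i := y)) \<partial>N"
    have g': "?g \<in> borel_measurable (\<Pi>\<^sub>M i\<in>I. N)"
      by measurable
    have "(\<integral>\<^sup>+x. (\<Prod>j\<in>insert i I. c (x j)) * g (\<lambda>j\<in>insert i I. T (x j)) \<partial>(\<Pi>\<^sub>M i\<in>insert i I. N)) =
      (\<integral>\<^sup>+x. \<integral>\<^sup>+y. (c y * (\<Prod>j\<in>I. c (x j))) * g ((\<lambda>j\<in>I. T (x j))(i := T y)) \<partial>N \<partial>(\<Pi>\<^sub>M i\<in>I. N))"
      using insert.hyps by (subst P.product_nn_integral_insert) (simp_all only: pr upd, measurable)
    also have "\<dots> = (\<integral>\<^sup>+x. C * ((\<Prod>j\<in>I. c (x j)) * ?g (\<lambda>j\<in>I. T (x j))) \<partial>(\<Pi>\<^sub>M i\<in>I. N))"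
    proof (rule nn_integral_cong)
      fix x assume x: "x \<in> space (\<Pi>\<^sub>M i\<in>I. N)"
      let ?T = "\<lambda>j\<in>I. T (x j)"
      have T: "?T \<in> space (\<Pi>\<^sub>M i\<in>I. N)"
        using x measurable_space[OF \<open>T \<in> measurable N N\<close>] by (auto simp: space_PiM)
      have [measurable]: "(\<lambda>y. g (?T(i := y))) \<in> borel_measurable N"
        using measurable_compose[OF measurable_component_update[OF T insert.hyps(2)] insert.prems]
        by (simp add: fun_upd_def)
      have "(\<lambda>y. g (?T(i := T y))) \<in> borel_measurable N"
        using measurable_compose[OF \<open>T \<in> measurable N N\<close>
          \<open>(\<lambda>y. g (?T(i := y))) \<in> borel_measurable N\<close>] .
      hence m: "(\<lambda>y. c y * g (?T(i := T y))) \<in> borel_measurable N"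
        by (intro borel_measurable_times_ennreal) auto
      have "(\<integral>\<^sup>+y. (c y * (\<Prod>j\<in>I. c (x j))) * g (?T(i := T y)) \<partial>N) =
          (\<Prod>j\<in>I. c (x j)) * (\<integral>\<^sup>+y. c y * g (?T(i := T y)) \<partial>N)"
        using m by (simp add: nn_integral_cmult[symmetric] mult_ac)
      also have "(\<integral>\<^sup>+y. c y * g (?T(i := T y)) \<partial>N) = C * ?g ?T"
        by (rule subst1) measurable
      finally show "(\<integral>\<^sup>+y. (c y * (\<Prod>j\<in>I. c (x j))) * g (?T(i := T y)) \<partial>N) =
          C * ((\<Prod>j\<in>I. c (x j)) * ?g ?T)"
        by (simp only: mult_ac)
    qed
    also have "\<dots> = C * (\<integral>\<^sup>+x. (\<Prod>j\<in>I. c (x j)) * ?g (\<lambda>j\<in>I. T (x j)) \<partial>(\<Pi>\<^sub>M i\<in>I. N))"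
      using g' by (intro nn_integral_cmult) measurable
    also have "\<dots> = C * (C ^ card I * (\<integral>\<^sup>+x. ?g x \<partial>(\<Pi>\<^sub>M i\<in>I. N)))"
      by (subst insert.IH[OF g']) simp
    also have "(\<integral>\<^sup>+x. ?g x \<partial>(\<Pi>\<^sub>M i\<in>I. N)) = (\<integral>\<^sup>+x. g x \<partial>(\<Pi>\<^sub>M i\<in>insert i I. N))"
      using insert.hyps by (subst P.product_nn_integral_insert) auto
    finally show ?case using insert.hyps by (simp add: mult_ac)
  qed
qed

section \<open>Uniform order statistics\<close>

abbreviation unif :: "real measure" where
  "unif \<equiv> uniform_measure lborel {0..1}"

definition ord_unif :: "nat \<Rightarrow> (nat \<Rightarrow> real) measure" where
  "ord_unif n = distr (\<Pi>\<^sub>M i\<in>{1..n}. unif) (\<Pi>\<^sub>M i\<in>{1..n}. borel) (ord_vec {1..n})"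

lemma prob_space_unif: "prob_space unif"
  by (rule prob_space_uniform_measure) auto

interpretation unif: prob_space unif
  by (rule prob_space_unif)

interpretation unif_prod: product_sigma_finite "\<lambda>_. unif"
  by unfold_locales

lemma sets_PiM_unif [measurable_cong]: "sets (\<Pi>\<^sub>M i\<in>I. unif) = sets (\<Pi>\<^sub>M i\<in>I. borel)"
  by (intro sets_PiM_cong) auto

lemma nn_integral_unif:
  "h \<in> borel_measurable borel \<Longrightarrow>
    (\<integral>\<^sup>+y. h y \<partial>unif) = (\<integral>\<^sup>+y. h y * indicator {0..1} y \<partial>lborel)"
  by (subst nn_integral_uniform_measure) (auto simp: divide_ennreal_def)

lemma AE_unif: "(AE x in lborel. x \<in> {0..1} \<longrightarrow> P x) \<Longrightarrow> AE x in unif. P x"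
  by (intro AE_uniform_measureI) auto

lemma AE_unif_neq: "AE x in unif. x \<noteq> c"
  by (intro AE_unif) (use AE_lborel_singleton[of c] in auto)

lemma AE_unif_open: "AE x in unif. 0 < x \<and> x < 1"
  by (intro AE_unif) (use AE_lborel_singleton[of 0] AE_lborel_singleton[of 1] in \<open>eventually_elim, auto\<close>)

lemma unif_scale:
  assumes [measurable]: "h \<in> borel_measurable borel" and w: "0 < w" "w \<le> 1"
  shows "(\<integral>\<^sup>+y. indicator {..<w} y * h (y / w) \<partial>unif) = ennreal w * (\<integral>\<^sup>+y. h y \<partial>unif)"
proof -
  have "(\<integral>\<^sup>+y. indicator {..<w} y * h (y / w) \<partial>unif) =
      (\<integral>\<^sup>+y. indicator {..<w} y * h (y / w) * indicator {0..1} y \<partial>lborel)"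
    by (rule nn_integral_unif) measurable
  also have "\<dots> = ennreal w * (\<integral>\<^sup>+y. indicator {..<w} (w * y) * h y * indicator {0..1} (w * y) \<partial>lborel)"
    using w by (subst nn_integral_real_affine[where c = w and t = 0]) auto
  also have "(\<integral>\<^sup>+y. indicator {..<w} (w * y) * h y * indicator {0..1} (w * y) \<partial>lborel) =
      (\<integral>\<^sup>+y. h y * indicator {0..1} y \<partial>lborel)"
  proof (rule nn_integral_cong_AE)
    have "indicator {..<w} (w * y) * h y * indicator {0..1} (w * y) = h y * indicator {0..1} y"
      if "y \<noteq> 1" for y
    proof -
      have "w * y < w \<longleftrightarrow> y < 1" "0 \<le> w * y \<longleftrightarrow> 0 \<le> y"
        using w by (auto simp: zero_le_mult_iff)
      moreover have "w * y \<le> 1" if "0 \<le> y" "y \<le> 1"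
        using w that by (intro mult_le_one) auto
      ultimately show ?thesis using w that by (auto simp: indicator_def)
    qed
    thus "AE y in lborel. indicator {..<w} (w * y) * h y * indicator {0..1} (w * y) =
        h y * indicator {0..1} y"
      using AE_lborel_singleton[of 1] by auto
  qed
  finally show ?thesis by (simp add: nn_integral_unif)
qed

lemma unif_reflect:
  assumes [measurable]: "h \<in> borel_measurable borel"
  shows "(\<integral>\<^sup>+y. h (1 - y) \<partial>unif) = (\<integral>\<^sup>+y. h y \<partial>unif)"
proof -
  have "(\<integral>\<^sup>+y. h (1 - y) \<partial>unif) = (\<integral>\<^sup>+y. h (1 - y) * indicator {0..1} y \<partial>lborel)"
    by (rule nn_integral_unif) measurable
  also have "\<dots> = (\<integral>\<^sup>+y. h y * indicator {0..1} (1 - y) \<partial>lborel)"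
    by (subst nn_integral_real_affine[where c = "-1" and t = 1]) auto
  also have "\<dots> = (\<integral>\<^sup>+y. h y * indicator {0..1} y \<partial>lborel)"
    by (intro nn_integral_cong) (auto simp: indicator_def)
  finally show ?thesis by (simp add: nn_integral_unif)
qed

lemma AE_PiM_unif_open:
  assumes "finite I"
  shows "AE x in \<Pi>\<^sub>M i\<in>I. unif. \<forall>i\<in>I. 0 < x i \<and> x i < 1"
  using assms AE_PiM_component[of I "\<lambda>_. unif"] prob_space_unif AE_unif_open
  by (intro AE_finite_allI) auto

text \<open>For \<open>i \<noteq> j\<close>, integrate first over the coordinate \<open>i\<close> with the others fixed: it avoids the single
  value \<open>x j\<close> almost surely.\<close>

lemma AE_PiM_unif_inj:
  assumes I: "finite I"
  shows "AE x in \<Pi>\<^sub>M i\<in>I. unif. inj_on x I"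
proof -
  have "AE x in \<Pi>\<^sub>M i\<in>I. unif. x i \<noteq> x j" if ij: "i \<in> I" "j \<in> I" "i \<noteq> j" for i j
  proof -
    have eq: "I = insert i (I - {i})" using ij by auto
    let ?f = "\<lambda>x :: 'a \<Rightarrow> real. indicator {0} (x i - x j) :: ennreal"
    have f: "?f \<in> borel_measurable (\<Pi>\<^sub>M i\<in>I. unif)"
      using ij by measurable
    have "(\<integral>\<^sup>+x. ?f x \<partial>(\<Pi>\<^sub>M i\<in>insert i (I - {i}). unif)) =
        (\<integral>\<^sup>+x. \<integral>\<^sup>+y. ?f (x(i := y)) \<partial>unif \<partial>(\<Pi>\<^sub>M i\<in>I - {i}. unif))"
      using I f by (intro unif_prod.product_nn_integral_insert) (auto simp: insert_absorb ij)
    also have "\<dots> = (\<integral>\<^sup>+x. 0 \<partial>(\<Pi>\<^sub>M i\<in>I - {i}. unif))"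
    proof (rule nn_integral_cong)
      fix x :: "'a \<Rightarrow> real"
      have "(\<integral>\<^sup>+y. ?f (x(i := y)) \<partial>unif) = (\<integral>\<^sup>+y. 0 \<partial>unif)"
        using AE_unif_neq[of "x j"] ij by (intro nn_integral_cong_AE) (auto simp: indicator_def)
      thus "(\<integral>\<^sup>+y. ?f (x(i := y)) \<partial>unif) = 0" by simp
    qed
    finally have "(\<integral>\<^sup>+x. ?f x \<partial>(\<Pi>\<^sub>M i\<in>I. unif)) = 0"
      using eq by simp
    hence "AE x in \<Pi>\<^sub>M i\<in>I. unif. ?f x = 0"
      using f by (subst (asm) nn_integral_0_iff_AE) auto
    thus ?thesis by eventually_elim (auto simp: indicator_def split: if_splits)
  qed
  hence "AE x in \<Pi>\<^sub>M i\<in>I. unif. \<forall>i\<in>I. \<forall>j\<in>I. i \<noteq> j \<longrightarrow> x i \<noteq> x j"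
    using I by (intro AE_finite_allI) auto
  thus ?thesis by eventually_elim (auto simp: inj_on_def)
qed

lemma measurable_ord_vec_unif:
  assumes "finite I" "card I = n"
  shows "ord_vec I \<in> measurable (\<Pi>\<^sub>M j\<in>I. unif) (\<Pi>\<^sub>M i\<in>{1..n}. borel)"
  using measurable_ord_vec[OF assms] by (simp add: measurable_cong_sets[OF sets_PiM_unif refl])

text \<open>Sorting forgets the labels, and independent identically distributed variables may be relabelled by
  any bijection, so the law of the order statistics depends on the index set only through its size.\<close>

lemma distr_ord_vec_unif:
  assumes I: "finite I" "card I = n"
  shows "distr (\<Pi>\<^sub>M i\<in>I. unif) (\<Pi>\<^sub>M i\<in>{1..n}. borel) (ord_vec I) = ord_unif n"
proof -
  obtain p where p: "bij_betw p {1..n} I"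
    using I by (metis card_atLeastAtMost diff_Suc_1 finite_atLeastAtMost finite_same_card_bij)
  let ?r = "\<lambda>u. \<lambda>i\<in>{1..n}. u (p i)"
  have r: "?r \<in> measurable (\<Pi>\<^sub>M i\<in>I. unif) (\<Pi>\<^sub>M i\<in>{1..n}. unif)"
    using p by (intro measurable_restrict measurable_component_singleton) (auto simp: bij_betw_def)
  have "(\<Pi>\<^sub>M i\<in>{1..n}. unif) = distr (\<Pi>\<^sub>M i\<in>I. unif) (\<Pi>\<^sub>M i\<in>{1..n}. unif) ?r"
    using p distr_PiM_reindex[of I "\<lambda>_. unif" p "{1..n}"] prob_space_unif
    by (auto simp: bij_betw_def)
  hence "ord_unif n = distr (\<Pi>\<^sub>M i\<in>I. unif) (\<Pi>\<^sub>M i\<in>{1..n}. borel) (ord_vec {1..n} \<circ> ?r)"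
    unfolding ord_unif_def using distr_distr[OF measurable_ord_vec_unif r, of n] by simp
  also have "ord_vec {1..n} \<circ> ?r = ord_vec I"
  proof
    fix u
    have "ord_values {1..n} (?r u) = ord_values {1..n} (\<lambda>i. u (p i))"
      by (rule ord_values_cong) auto
    also have "\<dots> = ord_values I u"
      by (rule ord_values_reindex) fact
    finally show "(ord_vec {1..n} \<circ> ?r) u = ord_vec I u"
      using I by (simp add: ord_vec_def)
  qed
  finally show ?thesis by simp
qed

lemma ord_values_scale:
  assumes "finite I" "0 < w"
  shows "ord_values I (\<lambda>i. u i / w) = map (\<lambda>t. t / w) (ord_values I u)"
  by (rule ord_values_mono) (use assms in \<open>auto simp: monotone_on_def divide_right_mono\<close>)

lemma nn_integral_unif_power:
  "(\<integral>\<^sup>+w. ennreal w ^ n \<partial>unif) = ennreal (1 / real (Suc n))"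
proof -
  have "(\<integral>\<^sup>+w. ennreal w ^ n \<partial>unif) = (\<integral>\<^sup>+w. ennreal w ^ n * indicator {0..1} w \<partial>lborel)"
    by (rule nn_integral_unif) measurable
  also have "\<dots> = (\<integral>\<^sup>+w. ennreal (w ^ n) * indicator {0..1} w \<partial>lborel)"
    by (intro nn_integral_cong) (auto simp: indicator_def ennreal_power)
  also have "\<dots> = ennreal (1 ^ Suc n / real (Suc n) - 0 ^ Suc n / real (Suc n))"
    by (rule nn_integral_FTC_Icc[where F = "\<lambda>w. w ^ Suc n / real (Suc n)"])
      (auto intro!: derivative_eq_intros simp del: of_nat_Suc power_Suc)
  finally show ?thesis by simp
qed

text \<open>Split according to the index \<open>k\<close> of the maximum, which is almost surely unique. Fix the value \<open>w\<close> of
  that coordinate. The remaining \<open>n\<close> coordinates are all below \<open>w\<close>, and the substitution \<open>y \<mapsto> y / w\<close>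
  turns their integral into \<open>w\<^sup>n\<close> times the integral over the whole unit cube of the same function of
  the order statistics. Since \<open>w\<^sup>n\<close> integrates to \<open>1 / (n + 1)\<close> and there are \<open>n + 1\<close> choices of
  \<open>k\<close>, the total is exactly the law of \<open>n\<close> uniform order statistics.\<close>

lemma ord_unif_max:
  "distr (ord_unif (Suc n)) (\<Pi>\<^sub>M i\<in>{1..n}. borel) (\<lambda>v. \<lambda>i\<in>{1..n}. v i / v (Suc n)) = ord_unif n"
  (is "distr _ ?B ?\<phi> = _")
proof (rule measure_eqI)
  show "sets (distr (ord_unif (Suc n)) ?B ?\<phi>) = sets (ord_unif n)"
    by (simp add: ord_unif_def)
next
  fix A assume "A \<in> sets (distr (ord_unif (Suc n)) ?B ?\<phi>)"
  hence A [measurable]: "A \<in> sets ?B" by simp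
  define I where "I = {1..Suc n}"
  have I [simp]: "finite I" "card I = Suc n" by (auto simp: I_def)
  have \<phi>: "?\<phi> \<in> measurable (\<Pi>\<^sub>M i\<in>I. borel) ?B"
    by (intro measurable_restrict) (auto simp: I_def)
  have ordI: "ord_vec I \<in> measurable (\<Pi>\<^sub>M i\<in>I. unif) (\<Pi>\<^sub>M i\<in>I. borel)"
    using measurable_ord_vec_unif[of I "Suc n"] by (simp add: I_def)
  \<comment> \<open>\<open>E k\<close> indicates that the maximum is attained at \<open>k\<close> only; it is a product over the other
    coordinates, as the substitution lemma requires. \<open>H k\<close> tests their normalised order statistics.\<close>
  define E where "E k x = (\<Prod>j\<in>I - {k}. indicator {..<x k} (x j) :: ennreal)"
    for k and x :: "nat \<Rightarrow> real"
  define H where "H k x = (indicator A (ord_vec (I - {k}) (\<lambda>j\<in>I - {k}. x j / x k)) :: ennreal)"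
    for k and x :: "nat \<Rightarrow> real"
  have E_meas: "E k \<in> borel_measurable (\<Pi>\<^sub>M i\<in>I. unif)" if "k \<in> I" for k
    unfolding E_def[abs_def] using that
    by (intro borel_measurable_prod_ennreal) (auto simp: indicator_def)
  have H_meas: "H k \<in> borel_measurable (\<Pi>\<^sub>M i\<in>I. unif)" if k: "k \<in> I" for k
  proof -
    have "(\<lambda>x. \<lambda>j\<in>I - {k}. x j / x k) \<in> measurable (\<Pi>\<^sub>M i\<in>I. unif) (\<Pi>\<^sub>M j\<in>I - {k}. borel)"
      using k by (intro measurable_restrict) auto
    from measurable_compose[OF this measurable_ord_vec[of "I - {k}" n]]
    have [measurable]: "(\<lambda>x. ord_vec (I - {k}) (\<lambda>j\<in>I - {k}. x j / x k)) \<in> measurable (\<Pi>\<^sub>M i\<in>I. unif) ?B"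
      using k by simp
    show ?thesis unfolding H_def[abs_def] by measurable
  qed
  have term_eq: "(\<integral>\<^sup>+x. E k x * H k x \<partial>(\<Pi>\<^sub>M i\<in>I. unif)) =
      ennreal (1 / real (Suc n)) * emeasure (ord_unif n) A" if k: "k \<in> I" for k
  proof -
    define J where "J = I - {k}"
    have J [simp]: "finite J" "card J = n" "k \<notin> J" and IJ: "I = insert k J"
      using k by (auto simp: J_def)
    have ordJ: "ord_vec J \<in> measurable (\<Pi>\<^sub>M j\<in>J. unif) ?B"
      by (intro measurable_ord_vec_unif) auto
    have g: "(\<lambda>x. indicator A (ord_vec J x) :: ennreal) \<in> borel_measurable (\<Pi>\<^sub>M j\<in>J. unif)"
      using ordJ by measurable
    have "(\<integral>\<^sup>+x. E k x * H k x \<partial>(\<Pi>\<^sub>M i\<in>I. unif)) =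
        (\<integral>\<^sup>+w. \<integral>\<^sup>+x. E k (x(k := w)) * H k (x(k := w)) \<partial>(\<Pi>\<^sub>M j\<in>J. unif) \<partial>unif)"
      unfolding IJ using E_meas[OF k] H_meas[OF k]
      by (intro unif_prod.product_nn_integral_insert_rev borel_measurable_times_ennreal)
        (auto simp: IJ)
    also have "\<dots> = (\<integral>\<^sup>+w. ennreal w ^ n * emeasure (ord_unif n) A \<partial>unif)"
    proof (rule nn_integral_cong_AE)
      have "(\<integral>\<^sup>+x. E k (x(k := w)) * H k (x(k := w)) \<partial>(\<Pi>\<^sub>M j\<in>J. unif)) =
          ennreal w ^ n * emeasure (ord_unif n) A" if w: "0 < w" "w < 1" for w
      proof -
        have "E k (x(k := w)) = (\<Prod>j\<in>J. indicator {..<w} (x j))" for x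
          unfolding E_def J_def[symmetric] by (intro prod.cong) auto
        moreover have "H k (x(k := w)) = indicator A (ord_vec J (\<lambda>j\<in>J. x j / w))" for x
        proof -
          have "(\<lambda>j\<in>J. (x(k := w)) j / (x(k := w)) k) = (\<lambda>j\<in>J. x j / w)"
            by (auto simp: fun_eq_iff)
          thus ?thesis unfolding H_def J_def[symmetric] by simp
        qed
        ultimately have "(\<integral>\<^sup>+x. E k (x(k := w)) * H k (x(k := w)) \<partial>(\<Pi>\<^sub>M j\<in>J. unif)) =
            (\<integral>\<^sup>+x. (\<Prod>j\<in>J. indicator {..<w} (x j)) *
              indicator A (ord_vec J (\<lambda>j\<in>J. x j / w)) \<partial>(\<Pi>\<^sub>M j\<in>J. unif))"
          by simp
        also have "\<dots> = ennreal w ^ card J * (\<integral>\<^sup>+x. indicator A (ord_vec J x) \<partial>(\<Pi>\<^sub>M j\<in>J. unif))"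
          using w g unif_scale[of _ w]
          by (intro product_nn_integral_substitution[where c = "indicator {..<w}" and T = "\<lambda>y. y / w"])
            (auto intro: unif.sigma_finite_measure)
        also have "(\<integral>\<^sup>+x. indicator A (ord_vec J x) \<partial>(\<Pi>\<^sub>M j\<in>J. unif)) =
            (\<integral>\<^sup>+v. indicator A v \<partial>distr (\<Pi>\<^sub>M j\<in>J. unif) ?B (ord_vec J))"
          by (intro nn_integral_distr[symmetric] ordJ borel_measurable_indicator) (use A in simp)
        also have "\<dots> = emeasure (ord_unif n) A"
          using A by (subst distr_ord_vec_unif) (auto simp: ord_unif_def)
        finally show ?thesis by (simp only: J(2))
      qed
      thus "AE w in unif. (\<integral>\<^sup>+x. E k (x(k := w)) * H k (x(k := w)) \<partial>(\<Pi>\<^sub>M j\<in>J. unif)) =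
          ennreal w ^ n * emeasure (ord_unif n) A"
        using AE_unif_open by auto
    qed
    also have "\<dots> = (\<integral>\<^sup>+w. ennreal w ^ n \<partial>unif) * emeasure (ord_unif n) A"
      by (intro nn_integral_multc) measurable
    finally show ?thesis by (simp only: nn_integral_unif_power)
  qed
  have pointwise: "indicator A (?\<phi> (ord_vec I x)) = (\<Sum>k\<in>I. E k x * H k x)"
    if inj: "inj_on x I" and pos: "\<forall>i\<in>I. 0 < x i \<and> x i < 1" for x
  proof -
    have "Max (x ` I) \<in> x ` I" using I by (intro Max_in) (auto simp: I_def)
    then obtain k where k: "k \<in> I" "x k = Max (x ` I)" by auto
    have less: "x j < x k" if "j \<in> I" "j \<noteq> k" for j
    proof -
      have "x j \<le> x k" using that k I by auto
      moreover have "x j \<noteq> x k" using inj_onD[OF inj, of j k] that k(1) by auto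
      ultimately show ?thesis by simp
    qed
    have E1: "E k x = 1"
      unfolding E_def using less by (intro prod.neutral) auto
    have E0: "E k' x = 0" if k': "k' \<in> I" "k' \<noteq> k" for k'
      unfolding E_def using k(1) k' less[OF k'] I by (intro prod_zero bexI[of _ k]) auto
    have "(\<Sum>k'\<in>I. E k' x * H k' x) = (\<Sum>k'\<in>I. if k' = k then H k x else 0)"
      by (intro sum.cong) (auto simp: E0 E1)
    also have "\<dots> = H k x" using k I by simp
    also have "H k x = indicator A (?\<phi> (ord_vec I x))"
    proof -
      have card: "card (I - {k}) = n" using k I by simp
      have "ord_values I x = ord_values (insert k (I - {k})) x"
        using k by (simp add: insert_absorb)
      also have "\<dots> = ord_values (I - {k}) x @ [x k]"
        using I by (intro ord_values_insert_max) (auto intro: less_imp_le less)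
      finally have split: "ord_values I x = ord_values (I - {k}) x @ [x k]" .
      have "ord_values (I - {k}) (\<lambda>j\<in>I - {k}. x j / x k) = ord_values (I - {k}) (\<lambda>j. x j / x k)"
        by (rule ord_values_cong) auto
      also have "\<dots> = map (\<lambda>t. t / x k) (ord_values (I - {k}) x)"
        using k pos by (intro ord_values_scale) auto
      finally have scaled: "ord_values (I - {k}) (\<lambda>j\<in>I - {k}. x j / x k) =
        map (\<lambda>t. t / x k) (ord_values (I - {k}) x)" .
      have "ord_vec (I - {k}) (\<lambda>j\<in>I - {k}. x j / x k) = ?\<phi> (ord_vec I x)"
        unfolding ord_vec_def card I(2) scaled
      proof (rule restrict_ext)
        fix i assume i: "i \<in> {1..n}"
        have len: "i - 1 < length (ord_values (I - {k}) x)"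
          unfolding length_ord_values card atLeastAtMost_iff using i by fastforce
        hence "ord_values I x ! (i - 1) = ord_values (I - {k}) x ! (i - 1)"
          unfolding split by (subst nth_append) simp
        moreover have "ord_values I x ! n = x k"
          unfolding split using card by (subst nth_append) simp
        ultimately show "map (\<lambda>t. t / x k) (ord_values (I - {k}) x) ! (i - 1) =
            (\<lambda>i\<in>{1..Suc n}. ord_values I x ! (i - 1)) i /
            (\<lambda>i\<in>{1..Suc n}. ord_values I x ! (i - 1)) (Suc n)"
          unfolding nth_map[OF len] using i by simp
      qed
      thus ?thesis by (simp add: H_def)
    qed
    finally show ?thesis by simp
  qed
  have "distr (ord_unif (Suc n)) ?B ?\<phi> = distr (\<Pi>\<^sub>M i\<in>I. unif) ?B (?\<phi> \<circ> ord_vec I)"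
    unfolding ord_unif_def I_def[symmetric] by (rule distr_distr[OF \<phi> ordI])
  hence "emeasure (distr (ord_unif (Suc n)) ?B ?\<phi>) A =
      (\<integral>\<^sup>+v. indicator A v \<partial>distr (\<Pi>\<^sub>M i\<in>I. unif) ?B (?\<phi> \<circ> ord_vec I))"
    using A by simp
  also have "\<dots> = (\<integral>\<^sup>+x. indicator A (?\<phi> (ord_vec I x)) \<partial>(\<Pi>\<^sub>M i\<in>I. unif))"
    using A by (subst nn_integral_distr[OF measurable_comp[OF ordI \<phi>]]) auto
  also have "\<dots> = (\<integral>\<^sup>+x. (\<Sum>k\<in>I. E k x * H k x) \<partial>(\<Pi>\<^sub>M i\<in>I. unif))"
  proof (rule nn_integral_cong_AE)
    show "AE x in \<Pi>\<^sub>M i\<in>I. unif. indicator A (?\<phi> (ord_vec I x)) = (\<Sum>k\<in>I. E k x * H k x)"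
      using AE_PiM_unif_inj[OF I(1)] AE_PiM_unif_open[OF I(1)]
      by eventually_elim (rule pointwise)
  qed
  also have "\<dots> = (\<Sum>k\<in>I. \<integral>\<^sup>+x. E k x * H k x \<partial>(\<Pi>\<^sub>M i\<in>I. unif))"
    using E_meas H_meas by (intro nn_integral_sum borel_measurable_times_ennreal)
  also have "\<dots> = (\<Sum>k\<in>I. ennreal (1 / real (Suc n)) * emeasure (ord_unif n) A)"
    by (intro sum.cong term_eq refl)
  also have "\<dots> = (of_nat (Suc n) * ennreal (1 / real (Suc n))) * emeasure (ord_unif n) A"
    by (simp del: of_nat_Suc add: mult.assoc)
  also have "of_nat (Suc n) * ennreal (1 / real (Suc n)) = 1"
    by (simp del: of_nat_Suc add: ennreal_of_nat_eq_real_of_nat ennreal_mult[symmetric])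
  finally show "emeasure (distr (ord_unif (Suc n)) ?B ?\<phi>) A = emeasure (ord_unif n) A" by (simp only: mult_1_left)
qed

text \<open>The map \<open>u \<mapsto> 1 - u\<close> preserves the uniform law and reverses the order.\<close>

lemma ord_unif_reflect:
  "distr (ord_unif n) (\<Pi>\<^sub>M i\<in>{1..n}. borel) (\<lambda>v. \<lambda>i\<in>{1..n}. 1 - v (Suc n - i)) = ord_unif n"
  (is "distr _ ?B ?\<rho> = _")
proof -
  let ?I = "{1..n}" and ?P = "\<Pi>\<^sub>M i\<in>{1..n}. unif"
  let ?r = "\<lambda>x. \<lambda>i\<in>?I. 1 - x i :: real"
  have \<rho>: "?\<rho> \<in> measurable ?B ?B"
    by (intro measurable_restrict borel_measurable_diff borel_measurable_const
        measurable_component_singleton) auto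
  have r: "?r \<in> measurable ?P ?P"
    by (intro measurable_restrict) auto
  have ordI: "ord_vec ?I \<in> measurable ?P ?B"
    by (intro measurable_ord_vec_unif) auto
  have P: "distr ?P ?P ?r = ?P"
  proof (rule measure_eqI)
    fix A assume A: "A \<in> sets (distr ?P ?P ?r)"
    hence "emeasure (distr ?P ?P ?r) A = (\<integral>\<^sup>+x. indicator A x \<partial>distr ?P ?P ?r)"
      by simp
    also have "\<dots> = (\<integral>\<^sup>+x. (\<Prod>i\<in>?I. 1) * indicator A (?r x) \<partial>?P)"
      using A r by (subst nn_integral_distr) auto
    also have "\<dots> = 1 ^ card ?I * (\<integral>\<^sup>+x. indicator A x \<partial>?P)"
      using A unif_reflect
      by (intro product_nn_integral_substitution[where c = "\<lambda>_. 1" and T = "\<lambda>y. 1 - y"])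
        (auto intro: unif.sigma_finite_measure)
    finally show "emeasure (distr ?P ?P ?r) A = emeasure ?P A"
      using A by simp
  qed simp
  have comm: "?\<rho> (ord_vec ?I x) = ord_vec ?I (?r x)" for x
  proof -
    have "ord_values ?I (?r x) = ord_values ?I (\<lambda>i. 1 - x i)"
      by (rule ord_values_cong) auto
    also have "\<dots> = rev (map (\<lambda>t. 1 - t) (ord_values ?I x))"
      by (rule ord_values_antimono) (auto simp: monotone_on_def)
    finally show ?thesis
      by (auto simp: ord_vec_def fun_eq_iff rev_nth)
  qed
  have "distr (ord_unif n) ?B ?\<rho> = distr ?P ?B (?\<rho> \<circ> ord_vec ?I)"
    unfolding ord_unif_def by (rule distr_distr[OF \<rho> ordI])
  also have "?\<rho> \<circ> ord_vec ?I = ord_vec ?I \<circ> ?r"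
    using comm by (auto simp: fun_eq_iff)
  also have "distr ?P ?B (ord_vec ?I \<circ> ?r) = distr (distr ?P ?P ?r) ?B (ord_vec ?I)"
    by (rule distr_distr[OF ordI r, symmetric])
  finally show ?thesis by (simp only: P flip: ord_unif_def)
qed

lemma sets_ord_unif [measurable_cong]: "sets (ord_unif n) = sets (\<Pi>\<^sub>M i\<in>{1..n}. borel)"
  by (simp add: ord_unif_def)

lemma AE_ord_unif_range:
  "AE v in ord_unif m. \<forall>i\<in>{1..m}. 0 < v i \<and> v i < 1"
proof -
  have "AE x in \<Pi>\<^sub>M i\<in>{1..m}. unif. \<forall>i\<in>{1..m}. 0 < ord_vec {1..m} x i \<and> ord_vec {1..m} x i < 1"
    using AE_PiM_unif_open[OF finite_atLeastAtMost, of 1 m]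
  proof (rule eventually_mono, intro ballI)
    fix x :: "nat \<Rightarrow> real" and i
    assume x: "\<forall>i\<in>{1..m}. 0 < x i \<and> x i < 1" and i: "i \<in> {1..m}"
    have "ord_values {1..m} x ! (i - 1) \<in> set (ord_values {1..m} x)"
      using i by (intro nth_mem) auto
    thus "0 < ord_vec {1..m} x i \<and> ord_vec {1..m} x i < 1"
      using x i by (auto simp: ord_vec_def)
  qed
  thus ?thesis
    unfolding ord_unif_def using measurable_ord_vec_unif[of "{1..m}" m]
    by (subst AE_distr_iff) auto
qed

text \<open>Reflection exchanges minimum and maximum, so this is the maximum case conjugated by the reflection:
  with \<open>v' i = 1 - v (n + 2 - i)\<close> the reflected vector, \<open>1 - v' (n + 1 - i) / v' (n + 1)\<close> equals
  \<open>(v (i + 1) - v 1) / (1 - v 1)\<close> as soon as \<open>v 1 < 1\<close>.\<close>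

lemma ord_unif_min:
  "distr (ord_unif (Suc n)) (\<Pi>\<^sub>M i\<in>{1..n}. borel) (\<lambda>v. \<lambda>i\<in>{1..n}. (v (Suc i) - v 1) / (1 - v 1)) =
    ord_unif n"
  (is "distr _ ?B ?\<psi> = _")
proof -
  let ?B' = "\<Pi>\<^sub>M i\<in>{1..Suc n}. (borel :: real measure)"
  let ?\<rho> = "\<lambda>v. \<lambda>i\<in>{1..n}. 1 - v (Suc n - i) :: real"
  let ?\<rho>' = "\<lambda>v. \<lambda>i\<in>{1..Suc n}. 1 - v (Suc (Suc n) - i) :: real"
  let ?\<phi> = "\<lambda>v. \<lambda>i\<in>{1..n}. v i / v (Suc n) :: real"
  have \<rho>: "?\<rho> \<in> measurable ?B ?B"
    by (intro measurable_restrict borel_measurable_diff borel_measurable_const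
        measurable_component_singleton) auto
  have \<rho>': "?\<rho>' \<in> measurable ?B' ?B'"
    by (intro measurable_restrict borel_measurable_diff borel_measurable_const
        measurable_component_singleton) auto
  have \<phi>: "?\<phi> \<in> measurable ?B' ?B" by (intro measurable_restrict) auto
  have cong: "measurable (ord_unif k) N = measurable (\<Pi>\<^sub>M i\<in>{1..k}. borel) N" for k and N :: "(nat \<Rightarrow> real) measure"
    by (intro measurable_cong_sets sets_ord_unif refl)
  have "ord_unif n = distr (distr (distr (ord_unif (Suc n)) ?B' ?\<rho>') ?B ?\<phi>) ?B ?\<rho>"
    by (simp only: ord_unif_reflect ord_unif_max)
  also have "\<dots> = distr (ord_unif (Suc n)) ?B (?\<rho> \<circ> ?\<phi> \<circ> ?\<rho>')"
    using \<rho> \<rho>' \<phi>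
    by (simp add: distr_distr cong measurable_comp[OF \<rho>' \<phi>] comp_assoc)
  also have "\<dots> = distr (ord_unif (Suc n)) ?B ?\<psi>"
  proof (rule distr_cong_AE)
    have "AE v in ord_unif (Suc n). v 1 < 1"
      using AE_ord_unif_range[of "Suc n"] by (rule eventually_mono) simp
    thus "AE v in ord_unif (Suc n). (?\<rho> \<circ> ?\<phi> \<circ> ?\<rho>') v = ?\<psi> v"
    proof eventually_elim
      case (elim v)
      thus ?case by (auto simp: fun_eq_iff field_simps Suc_diff_le)
    qed
  qed (use \<rho> \<rho>' \<phi> in \<open>auto simp: cong intro!: measurable_restrict measurable_comp\<close>)
  finally show ?thesis by simp
qed

section \<open>Distribution functions with a density\<close>

locale density_distribution =
  fixes f :: "real \<Rightarrow> real" and F :: "real \<Rightarrow> real"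
  assumes f_nonneg: "0 \<le> f x"
    and f_measurable [measurable]: "f \<in> borel_measurable borel"
    and prob_density: "prob_space (density lborel (\<lambda>x. ennreal (f x)))"
    and F_eq: "F = cdf (density lborel (\<lambda>x. ennreal (f x)))"
begin

abbreviation law :: "real measure" where
  "law \<equiv> density lborel (\<lambda>x. ennreal (f x))"

sublocale law: cdf_distribution law
  unfolding cdf_distribution_def real_distribution_def real_distribution_axioms_def
  using prob_density by auto

lemma AE_law_neq: "AE x in law. x \<noteq> c"
  using AE_lborel_singleton[of c] by (subst AE_density) auto

lemma F_mono: "mono F"
  unfolding F_eq by (rule law.mono)

lemma F_measurable [measurable]: "F \<in> borel_measurable borel"
  unfolding F_eq by (rule law.measurable_C)

lemma isCont_F: "isCont F x"
proof -
  have "measure law {x} = measure law {}"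
    using AE_law_neq[of x] by (intro measure_eq_AE) auto
  thus ?thesis by (simp add: F_eq law.isCont_cdf)
qed

lemma F_diff_eq:
  assumes "s \<le> t" shows "F t - F s = measure law {s<..<t}"
proof (cases "s < t")
  case True
  have "measure law {s<..t} = measure law {s<..<t}"
    using AE_law_neq[of t] by (intro measure_eq_AE) auto
  thus ?thesis using law.cdf_diff_eq[OF True] by (simp add: F_eq)
qed (use assms in auto)

lemma emeasure_law_Ioo:
  assumes "s \<le> t"
  shows "(\<integral>\<^sup>+y. ennreal (f y) * indicator {s<..<t} y \<partial>lborel) = ennreal (F t - F s)"
  using assms by (simp add: F_diff_eq law.emeasure_eq_measure[symmetric] emeasure_density)

lemma F_diff_le:
  assumes "s \<le> t" "0 \<le> c" "\<And>y. s < y \<Longrightarrow> y < t \<Longrightarrow> f y \<le> c"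
  shows "F t - F s \<le> c * (t - s)"
proof -
  have "ennreal (F t - F s) \<le> (\<integral>\<^sup>+y. ennreal c * indicator {s<..<t} y \<partial>lborel)"
    unfolding emeasure_law_Ioo[OF assms(1), symmetric]
    using assms by (intro nn_integral_mono) (auto simp: indicator_def ennreal_leI)
  also have "\<dots> = ennreal (c * (t - s))"
    using assms by (simp add: nn_integral_cmult ennreal_mult)
  finally show ?thesis using assms by (simp add: ennreal_le_iff)
qed

lemma F_diff_ge:
  assumes "s \<le> t" "0 \<le> c" "\<And>y. s < y \<Longrightarrow> y < t \<Longrightarrow> c \<le> f y"
  shows "c * (t - s) \<le> F t - F s"
proof -
  have "ennreal (c * (t - s)) = (\<integral>\<^sup>+y. ennreal c * indicator {s<..<t} y \<partial>lborel)"
    using assms by (simp add: nn_integral_cmult ennreal_mult)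
  also have "\<dots> \<le> ennreal (F t - F s)"
    unfolding emeasure_law_Ioo[OF assms(1), symmetric]
    using assms by (intro nn_integral_mono) (auto simp: indicator_def ennreal_leI)
  finally show ?thesis using monoD[OF F_mono assms(1)] by (simp add: ennreal_le_iff)
qed

text \<open>A convex function lies below its chord. Convexity is used in the following form: the slope of \<open>F\<close> over
  \<open>(a,x)\<close> is at most \<open>f x\<close>, which is at most its slope over \<open>(x,b)\<close>.\<close>

lemma F_chord_mono:
  assumes "a < x" "x < b" "F a < F b" and mono: "mono_on {a<..<b} f"
  shows "(F x - F a) / (F b - F a) \<le> (x - a) / (b - a)"
proof -
  have "F x - F a \<le> f x * (x - a)"
    using assms by (intro F_diff_le f_nonneg) (auto intro!: mono_onD[OF mono])
  hence 1: "(F x - F a) * (b - x) \<le> f x * (x - a) * (b - x)"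
    using assms by (intro mult_right_mono) auto
  have "f x * (b - x) \<le> F b - F x"
    using assms by (intro F_diff_ge f_nonneg) (auto intro!: mono_onD[OF mono])
  hence 2: "f x * (b - x) * (x - a) \<le> (F b - F x) * (x - a)"
    using assms by (intro mult_right_mono) auto
  have "(F x - F a) * (b - a) \<le> (x - a) * (F b - F a)"
    using 1 2 by (simp add: algebra_simps)
  thus ?thesis using assms by (simp add: divide_simps)
qed

lemma F_chord_antimono:
  assumes "a < x" "x < b" "F a < F b" and anti: "antimono_on {a<..<b} f"
  shows "(x - a) / (b - a) \<le> (F x - F a) / (F b - F a)"
proof -
  have "f x * (x - a) \<le> F x - F a"
    using assms by (intro F_diff_ge f_nonneg) (auto intro!: monotone_onD[OF anti])
  hence 1: "f x * (x - a) * (b - x) \<le> (F x - F a) * (b - x)"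
    using assms by (intro mult_right_mono) auto
  have "F b - F x \<le> f x * (b - x)"
    using assms by (intro F_diff_le f_nonneg) (auto intro!: monotone_onD[OF anti])
  hence 2: "(F b - F x) * (x - a) \<le> f x * (b - x) * (x - a)"
    using assms by (intro mult_right_mono) auto
  have "(x - a) * (F b - F a) \<le> (F x - F a) * (b - a)"
    using 1 2 by (simp add: algebra_simps)
  thus ?thesis using assms by (simp add: divide_simps)
qed

text \<open>The probability integral transform. The law is the image of the uniform distribution under the
  quantile function, and continuity of \<open>F\<close> makes the quantile function a right inverse of \<open>F\<close>.\<close>

lemma distr_F_uniform: "distr law borel F = uniform_measure lborel {0..1}"
proof -
  let ?\<Omega> = "restrict_space lborel {0<..<1::real}"
  have I: "law.I \<in> measurable ?\<Omega> borel"
    by (subst measurable_cong_sets[OF sets_restrict_space_cong[OF sets_lborel] refl])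
      (rule law.measurable_CI)
  have FI: "F (law.I w) = w" if w: "0 < w" "w < 1" for w
  proof (rule antisym)
    show "w \<le> F (law.I w)"
      using law.pseudoinverse[OF w, of "law.I w"] unfolding F_eq by blast
    show "F (law.I w) \<le> w"
    proof (rule tendsto_upperbound)
      show "(F \<longlongrightarrow> F (law.I w)) (at_left (law.I w))"
        using isCont_F by (simp add: continuous_at filterlim_at_split)
      have "F y \<le> w" if "y < law.I w" for y
        using law.pseudoinverse[OF w, of y] that by (simp add: F_eq)
      thus "\<forall>\<^sub>F y in at_left (law.I w). F y \<le> w"
        by (auto simp: eventually_at_left_field intro: exI[of _ "law.I w - 1"])
    qed simp
  qed
  have "distr law borel F = distr (distr ?\<Omega> borel law.I) borel F"
    by (subst law.distr_I_eq_M) simp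
  also have "\<dots> = distr ?\<Omega> borel (F \<circ> law.I)"
    by (rule distr_distr[OF F_measurable I])
  also have "\<dots> = distr ?\<Omega> borel (\<lambda>w. w)"
    unfolding o_def by (rule distr_cong[OF refl refl FI]) (simp_all add: space_restrict_space)
  also have "\<dots> = uniform_measure lborel {0..1}"
  proof (rule measure_eqI)
    fix A assume "A \<in> sets (distr ?\<Omega> borel (\<lambda>w. w))"
    hence [measurable]: "A \<in> sets borel" by simp
    have "emeasure (distr ?\<Omega> borel (\<lambda>w. w)) A = emeasure lborel (A \<inter> {0<..<1})"
      by (subst emeasure_distr)
        (auto simp: space_restrict_space emeasure_restrict_space intro!: measurable_restrict_space1)
    also have "\<dots> = emeasure lborel ({0..1} \<inter> A)"
    proof (rule emeasure_eq_AE)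
      show "AE x in lborel. x \<in> A \<inter> {0<..<1} \<longleftrightarrow> x \<in> {0..1} \<inter> A"
        using AE_lborel_singleton[of 0] AE_lborel_singleton[of 1] by eventually_elim auto
    qed auto
    finally show "emeasure (distr ?\<Omega> borel (\<lambda>w. w)) A = emeasure (uniform_measure lborel {0..1}) A"
      by (simp add: divide_ennreal_def)
  qed simp
  finally show ?thesis .
qed

text \<open>The formula holds for every vector \<open>V\<close>, ordered or not and with a vanishing denominator allowed, so it
  yields measurability of \<open>U\<close> on the whole probability space and not only up to a null set. When
  \<open>F (V k) = F (V j)\<close>, both sides are 0 because division by 0 gives 0.\<close>

lemma local_cdf_eq:
  "local_cdf F f V j k x =
    (if V j < V k then (F (max (V j) (min x (V k))) - F (V j)) / (F (V k) - F (V j)) else 0)"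
proof -
  let ?d = "F (V k) - F (V j)" and ?z = "max (V j) (min x (V k))"
  have "local_cdf F f V j k x =
      enn2real (\<integral>\<^sup>+y. ennreal (indicator {V j<..<V k} y * f y / ?d) * indicator {..x} y \<partial>lborel)"
    by (simp add: local_cdf_def cdf_def measure_def local_density_def emeasure_density)
  also have "\<dots> = (if V j < V k then (F ?z - F (V j)) / ?d else 0)"
  proof (cases "V j < V k \<and> ?d \<noteq> 0")
    case False
    thus ?thesis by (cases "V j < V k") (simp_all add: greaterThanLessThan_empty)
  next
    case True
    hence d: "0 < ?d" using monoD[OF F_mono, of "V j" "V k"] by auto
    have "(\<integral>\<^sup>+y. ennreal (indicator {V j<..<V k} y * f y / ?d) * indicator {..x} y \<partial>lborel) =
        (\<integral>\<^sup>+y. ennreal (1 / ?d) * (ennreal (f y) * indicator {V j<..<?z} y) \<partial>lborel)"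
      using AE_lborel_singleton[of x]
    proof (intro nn_integral_cong_AE, eventually_elim)
      case (elim y)
      have "y \<in> {V j<..<V k} \<inter> {..x} \<longleftrightarrow> y \<in> {V j<..<?z}"
        using elim True by auto
      moreover have "ennreal (f y / ?d) = ennreal (1 / ?d) * ennreal (f y)"
        using d f_nonneg by (simp add: ennreal_mult[symmetric])
      ultimately show ?case by (auto simp: indicator_def)
    qed
    also have "\<dots> = ennreal (1 / ?d) * ennreal (F ?z - F (V j))"
      by (simp add: nn_integral_cmult emeasure_law_Ioo)
    finally show ?thesis
      using True d monoD[OF F_mono, of "V j" ?z] by (simp add: ennreal_mult[symmetric])
  qed
  finally show ?thesis .
qed

text \<open>The constants \<open>c\<close> and \<open>d\<close> cancel in the ratios, so the comparison of \<open>V\<close> with \<open>W\<close> is that of the line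
  with \<open>F\<close> on the interval from \<open>V j\<close> to \<open>V k\<close>.\<close>

lemma T_stat_comparison:
  fixes V W :: "nat \<Rightarrow> real"
  assumes V: "strict_mono_on {0..N} V" and FV: "strict_mono_on {0..N} (\<lambda>i. F (V i))"
    and W: "\<And>i. i \<le> N \<Longrightarrow> W i = (F (V i) - c) / d" and d: "0 < d"
    and jk: "j < k" "k \<le> N"
  shows "mono_on {V j<..<V k} f \<Longrightarrow> T_stat j k W \<le> T_stat j k V"
    and "antimono_on {V j<..<V k} f \<Longrightarrow> T_stat j k V \<le> T_stat j k W"
proof -
  let ?v = "\<lambda>i. (V i - V j) / (V k - V j)" and ?w = "\<lambda>i. (W i - W j) / (W k - W j)"
  have i: "V j < V i" "V i < V k" "F (V j) < F (V i)" "F (V i) < F (V k)"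
    if "i \<in> {j + 1..k - 1}" for i
    using that jk strict_mono_onD[OF V] strict_mono_onD[OF FV] by auto
  have w: "?w i = (F (V i) - F (V j)) / (F (V k) - F (V j))" if "i \<in> {j + 1..k - 1}" for i
  proof -
    have "W i - W j = (F (V i) - F (V j)) / d" "W k - W j = (F (V k) - F (V j)) / d"
      using that jk by (auto simp: W diff_divide_distrib)
    thus ?thesis using d by simp
  qed
  have range: "?v i \<in> {0<..<1}" "?w i \<in> {0<..<1}" if "i \<in> {j + 1..k - 1}" for i
    using i[OF that] by (auto simp: w[OF that] divide_simps)
  have le: "beta_weight s \<le> beta_weight t" if "s \<in> {0<..<1}" "t \<in> {0<..<1}" "s \<le> t" for s t
    using that by (simp add: beta_weight_def)
  show "T_stat j k W \<le> T_stat j k V" if "mono_on {V j<..<V k} f"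
    unfolding T_stat_def
  proof (rule sum_mono)
    fix i assume "i \<in> {j + 1..k - 1}"
    thus "beta_weight (?w i) \<le> beta_weight (?v i)"
      using i[of i] that by (intro le range) (auto simp: w intro!: F_chord_mono)
  qed
  show "T_stat j k V \<le> T_stat j k W" if "antimono_on {V j<..<V k} f"
    unfolding T_stat_def
  proof (rule sum_mono)
    fix i assume "i \<in> {j + 1..k - 1}"
    thus "beta_weight (?v i) \<le> beta_weight (?w i)"
      using i[of i] that by (intro le range) (auto simp: w intro!: F_chord_antimono)
  qed
qed

end

section \<open>Normalisation by known or observed endpoints\<close>

definition pad :: "real option \<Rightarrow> real option \<Rightarrow> real list \<Rightarrow> real list" where
  "pad lo up xs = (case lo of None \<Rightarrow> [] | Some a \<Rightarrow> [a]) @ xs @ (case up of None \<Rightarrow> [] | Some b \<Rightarrow> [b])"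

lemma length_pad:
  "length (pad lo up xs) =
    length xs + (if lo = None then 0 else 1) + (if up = None then 0 else 1)"
  by (auto simp: pad_def split: option.splits)

lemma extended_order_stat_eq_pad:
  "extended_order_stat lo up m y i = pad lo up (ord_values {1..m} y) ! i"
proof -
  have "map (order_stat m y) [1..<Suc m] = ord_values {1..m} y"
    by (rule nth_equalityI) (auto simp: order_stat_eq_ord_values simp del: upt_Suc)
  thus ?thesis by (simp add: extended_order_stat_def pad_def)
qed

text \<open>The map that sends \<open>F(Y\<^sub>1), \<dots>, F(Y\<^sub>m)\<close>, once sorted, to \<open>U\<^sub>(\<^sub>1\<^sub>), \<dots>, U\<^sub>(\<^sub>n\<^sub>)\<close>. Only the presence of
  the known endpoints enters, since \<open>F\<close> takes them to 0 and 1.\<close>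

definition spacing_ratios ::
  "real option \<Rightarrow> real option \<Rightarrow> nat \<Rightarrow> nat \<Rightarrow> (nat \<Rightarrow> real) \<Rightarrow> nat \<Rightarrow> real" where
  "spacing_ratios lo up m n v = (\<lambda>i\<in>{1..n}.
    let e = pad (map_option (\<lambda>_. 0) lo) (map_option (\<lambda>_. 1) up) (map v [1..<Suc m])
    in (e ! i - e ! 0) / (e ! (n + 1) - e ! 0))"

lemma nth_pad:
  assumes "i < length (pad lo up xs)"
  shows "pad lo up xs ! i =
    (let j = (if lo = None then i else i - 1)
     in if lo \<noteq> None \<and> i = 0 then the lo else if j < length xs then xs ! j else the up)"
  using assms by (cases lo; cases up; cases i) (auto simp: pad_def nth_append nth_Cons')

lemma measurable_pad_nth:
  assumes v: "\<And>j. j \<in> {1..m} \<Longrightarrow> (\<lambda>x. v x j) \<in> borel_measurable N"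
    and i: "i < m + (if lo = None then 0 else 1) + (if up = None then 0 else 1)"
  shows "(\<lambda>x. pad lo up (map (v x) [1..<Suc m]) ! i) \<in> borel_measurable N"
proof -
  define j where "j = (if lo = None then i else i - 1)"
  have eq: "(\<lambda>x. pad lo up (map (v x) [1..<Suc m]) ! i) =
      (\<lambda>x. if lo \<noteq> None \<and> i = 0 then the lo else if j < m then v x (Suc j) else the up)"
    using i by (intro ext, subst nth_pad) (auto simp: j_def length_pad Let_def simp del: upt_Suc)
  have "(\<lambda>x. v x (Suc j)) \<in> borel_measurable N" if "j < m"
    using that by (intro v) auto
  thus ?thesis
    unfolding eq by (cases "lo \<noteq> None \<and> i = 0"; cases "j < m") auto
qed

lemma measurable_spacing_ratios:
  assumes n: "n + 2 = m + (if lo = None then 0 else 1) + (if up = None then 0 else 1)"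
  shows "spacing_ratios lo up m n \<in> measurable (\<Pi>\<^sub>M i\<in>{1..m}. borel) (\<Pi>\<^sub>M i\<in>{1..n}. borel)"
  unfolding spacing_ratios_def[abs_def] Let_def
  using n
  by (intro measurable_restrict borel_measurable_divide borel_measurable_diff measurable_pad_nth
      measurable_component_singleton) (auto simp: length_pad split: if_splits)

text \<open>The four cases of known endpoints: the identity, division by the maximum, removal of the minimum, or
  both removals in succession. In the last case the removed maximum cancels, so that the composite
  is normalised by the range \<open>v (n + 2) - v 1\<close> of the original sample.\<close>

lemma distr_spacing_ratios_ord_unif:
  assumes n: "n + 2 = m + (if lo = None then 0 else 1) + (if up = None then 0 else 1)"
  shows "distr (ord_unif m) (\<Pi>\<^sub>M i\<in>{1..n}. borel) (spacing_ratios lo up m n) = ord_unif n"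
proof -
  have cong: "measurable (ord_unif k) N = measurable (\<Pi>\<^sub>M i\<in>{1..k}. borel) N"
    for k and N :: "(nat \<Rightarrow> real) measure"
    by (intro measurable_cong_sets sets_ord_unif refl)
  have space: "space (ord_unif k) = (\<Pi>\<^sub>E i\<in>{1..k}. UNIV)" for k
    using sets_eq_imp_space_eq[OF sets_ord_unif, of k] by (simp add: space_PiM)
  show ?thesis
  proof (cases lo; cases up)
    fix a b assume [simp]: "lo = Some a" "up = Some b"
    have [simp]: "m = n" using n by simp
    have "distr (ord_unif m) (\<Pi>\<^sub>M i\<in>{1..n}. borel) (spacing_ratios lo up m n) =
        distr (ord_unif n) (\<Pi>\<^sub>M i\<in>{1..n}. borel) (\<lambda>v. v)"
      by (rule distr_cong) (auto simp: space spacing_ratios_def pad_def fun_eq_iff nth_append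
          extensional_def PiE_def nth_Cons' simp del: upt_Suc)
    also have "\<dots> = ord_unif n"
      using distr_id2[OF sets_ord_unif[symmetric]] by simp
    finally show ?thesis .
  next
    fix a assume [simp]: "lo = Some a" "up = None"
    have [simp]: "m = Suc n" using n by simp
    have "distr (ord_unif m) (\<Pi>\<^sub>M i\<in>{1..n}. borel) (spacing_ratios lo up m n) =
        distr (ord_unif (Suc n)) (\<Pi>\<^sub>M i\<in>{1..n}. borel) (\<lambda>v. \<lambda>i\<in>{1..n}. v i / v (Suc n))"
      by (rule distr_cong) (auto simp: spacing_ratios_def pad_def fun_eq_iff nth_append nth_Cons'
          simp del: upt_Suc)
    thus ?thesis by (simp only: ord_unif_max)
  next
    fix b assume [simp]: "lo = None" "up = Some b"
    have [simp]: "m = Suc n" using n by simp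
    have "distr (ord_unif m) (\<Pi>\<^sub>M i\<in>{1..n}. borel) (spacing_ratios lo up m n) =
        distr (ord_unif (Suc n)) (\<Pi>\<^sub>M i\<in>{1..n}. borel)
          (\<lambda>v. \<lambda>i\<in>{1..n}. (v (Suc i) - v 1) / (1 - v 1))"
      by (rule distr_cong) (auto simp: spacing_ratios_def pad_def fun_eq_iff nth_append nth_Cons'
          simp del: upt_Suc)
    thus ?thesis by (simp only: ord_unif_min)
  next
    assume [simp]: "lo = None" "up = None"
    have [simp]: "m = Suc (Suc n)" using n by simp
    let ?B' = "\<Pi>\<^sub>M i\<in>{1..Suc n}. (borel :: real measure)"
    let ?B'' = "\<Pi>\<^sub>M i\<in>{1..Suc (Suc n)}. (borel :: real measure)"
    let ?B = "\<Pi>\<^sub>M i\<in>{1..n}. (borel :: real measure)"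
    let ?\<phi> = "\<lambda>v. \<lambda>i\<in>{1..Suc n}. v i / v (Suc (Suc n)) :: real"
    let ?\<psi> = "\<lambda>v. \<lambda>i\<in>{1..n}. (v (Suc i) - v 1) / (1 - v 1) :: real"
    have \<phi>: "?\<phi> \<in> measurable ?B'' ?B'"
      by (intro measurable_restrict borel_measurable_divide measurable_component_singleton) auto
    have \<psi>: "?\<psi> \<in> measurable ?B' ?B"
      by (intro measurable_restrict borel_measurable_divide borel_measurable_diff
          borel_measurable_const measurable_component_singleton) auto
    have "distr (ord_unif m) ?B (spacing_ratios lo up m n) =
        distr (ord_unif (Suc (Suc n))) ?B (?\<psi> \<circ> ?\<phi>)"
    proof (rule distr_cong_AE)
      show "AE v in ord_unif m. spacing_ratios lo up m n v = (?\<psi> \<circ> ?\<phi>) v"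
        using AE_ord_unif_range[of m]
      proof (rule eventually_mono)
        fix v :: "nat \<Rightarrow> real" assume "\<forall>i\<in>{1..m}. 0 < v i \<and> v i < 1"
        hence V: "0 < v (Suc (Suc n))" by simp
        have "(v (Suc i) / v (Suc (Suc n)) - v 1 / v (Suc (Suc n))) / (1 - v 1 / v (Suc (Suc n))) =
            (v (Suc i) - v 1) / (v (Suc (Suc n)) - v 1)" for i
        proof -
          have "1 - v 1 / v (Suc (Suc n)) = (v (Suc (Suc n)) - v 1) / v (Suc (Suc n))"
            using V by (simp add: diff_divide_distrib)
          thus ?thesis using V by (simp flip: diff_divide_distrib)
        qed
        thus "spacing_ratios lo up m n v = (?\<psi> \<circ> ?\<phi>) v"
          by (auto simp: spacing_ratios_def pad_def fun_eq_iff simp del: upt_Suc)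
      qed
    qed (use measurable_spacing_ratios[OF n] measurable_comp[OF \<phi> \<psi>] in \<open>auto simp: cong\<close>)
    also have "\<dots> = distr (distr (ord_unif (Suc (Suc n))) ?B' ?\<phi>) ?B ?\<psi>"
      using \<phi> \<psi> by (intro distr_distr[symmetric]) (simp_all add: cong)
    finally show ?thesis by (simp only: ord_unif_max ord_unif_min)
  qed
qed

theorem proposition2p1:
  fixes M :: "'a measure" and Y :: "nat \<Rightarrow> 'a \<Rightarrow> real"
    and F f :: "real \<Rightarrow> real" and lo up :: "real option"
    and m n :: nat and X U :: "'a \<Rightarrow> nat \<Rightarrow> real"
  assumes "prob_space M"
    and "m \<ge> 1"
    and "prob_space.indep_vars M (\<lambda>_. borel) Y {1..m}"
    and "\<And>x. 0 \<le> f x"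
    and "\<And>i. i \<in> {1..m} \<Longrightarrow> distributed M lborel (Y i) (\<lambda>x. ennreal (f x))"
    and "\<And>i. i \<in> {1..m} \<Longrightarrow> cdf (distr M borel (Y i)) = F"
    and "\<And>i. i \<in> {1..m} \<Longrightarrow> AE \<omega> in M. Y i \<omega> \<in> support_region lo up"
    and "\<And>a b. lo = Some a \<Longrightarrow> up = Some b \<Longrightarrow> a < b"
    and n: "n + 2 = m + (if lo = None then 0 else 1) + (if up = None then 0 else 1)"
    and X: "\<And>\<omega>. X \<omega> = extended_order_stat lo up m (\<lambda>i. Y i \<omega>)"
    and U: "\<And>\<omega> i. U \<omega> i = local_cdf F f (X \<omega>) 0 (n + 1) (X \<omega> i)"
  shows "(\<lambda>\<omega>. \<lambda>i\<in>{1..n}. U \<omega> i) \<in> measurable M (\<Pi>\<^sub>M i\<in>{1..n}. borel)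
    \<and> distr M (\<Pi>\<^sub>M i\<in>{1..n}. borel) (\<lambda>\<omega>. \<lambda>i\<in>{1..n}. U \<omega> i)
        = distr (\<Pi>\<^sub>M i\<in>{1..n}. uniform_measure lborel {0..1}) (\<Pi>\<^sub>M i\<in>{1..n}. borel)
            (\<lambda>u. \<lambda>i\<in>{1..n}. order_stat n u i)
    \<and> (AE \<omega> in M. U \<omega> 0 = 0 \<and> U \<omega> (n + 1) = 1)
    \<and> (AE \<omega> in M. strict_mono_on {0..n + 1} (X \<omega>) \<and> strict_mono_on {0..n + 1} (U \<omega>))
    \<and> (AE \<omega> in M. \<forall>j k. j < k \<and> k \<le> n + 1 \<and> k - j > 1 \<longrightarrow>
          (mono_on {X \<omega> j<..<X \<omega> k} f \<longrightarrow> T_stat j k (X \<omega>) \<ge> T_stat j k (U \<omega>))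
        \<and> (antimono_on {X \<omega> j<..<X \<omega> k} f \<longrightarrow> T_stat j k (X \<omega>) \<le> T_stat j k (U \<omega>)))"
proof -
  note [simp del] = upt_Suc
  interpret prob_space M by fact
  let ?L = "density lborel (\<lambda>x. ennreal (f x))"
  let ?B = "\<Pi>\<^sub>M i\<in>{1..n}. (borel :: real measure)"
  have Y [measurable]: "Y i \<in> borel_measurable M" if "i \<in> {1..m}" for i
    using distributed_measurable[OF assms(5)[OF that]] by simp
  have law: "distr M borel (Y i) = ?L" if "i \<in> {1..m}" for i
    using distributed_distr_eq_density[OF assms(5)[OF that]]
    by (metis distr_cong sets_lborel)
  have 1: "1 \<in> {1..m}" using assms(2) by simp
  have "(\<lambda>x. ennreal (f x)) \<in> borel_measurable borel"
    using distributed_borel_measurable[OF assms(5)[OF 1]] by simp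
  hence "(\<lambda>x. enn2real (ennreal (f x))) \<in> borel_measurable borel"
    by measurable
  hence f: "f \<in> borel_measurable borel"
    using assms(4) by simp
  interpret density_distribution f F
  proof (rule density_distribution.intro)
    show "prob_space ?L"
      using prob_space_distr[OF Y[OF 1]] unfolding law[OF 1] .
    show "F = cdf ?L" using assms(6)[OF 1] law[OF 1] by simp
  qed (use assms(4) f in auto)

  define W where "W \<omega> = (\<lambda>i\<in>{1..m}. F (Y i \<omega>))" for \<omega>
  have W: "W \<in> measurable M (\<Pi>\<^sub>M i\<in>{1..m}. borel)"
    unfolding W_def[abs_def] by (intro measurable_restrict measurable_compose[OF Y F_measurable])
  have W_distr: "distr M (\<Pi>\<^sub>M i\<in>{1..m}. borel) W = (\<Pi>\<^sub>M i\<in>{1..m}. unif)"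
  proof -
    have "indep_vars (\<lambda>_. borel) (\<lambda>i \<omega>. F (Y i \<omega>)) {1..m}"
      using assms(3) by (rule indep_vars_compose2) auto
    hence "distr M (\<Pi>\<^sub>M i\<in>{1..m}. borel) W = (\<Pi>\<^sub>M i\<in>{1..m}. distr M borel (\<lambda>\<omega>. F (Y i \<omega>)))"
      unfolding W_def[abs_def] using 1
      by (subst (asm) indep_vars_iff_distr_eq_PiM') (auto intro: measurable_compose[OF Y F_measurable])
    also have "\<dots> = (\<Pi>\<^sub>M i\<in>{1..m}. unif)"
    proof (rule PiM_cong)
      fix i assume i: "i \<in> {1..m}"
      have "distr M borel (\<lambda>\<omega>. F (Y i \<omega>)) = distr (distr M borel (Y i)) borel F"
        by (subst distr_distr[OF F_measurable Y[OF i]]) (simp add: o_def)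
      thus "distr M borel (\<lambda>\<omega>. F (Y i \<omega>)) = unif"
        by (simp add: law[OF i] distr_F_uniform)
    qed simp
    finally show ?thesis .
  qed
  have AE_W: "AE \<omega> in M. P (W \<omega>)" if "AE x in \<Pi>\<^sub>M i\<in>{1..m}. unif. P x" for P
    using AE_distrD[OF W] that unfolding W_distr by blast
  have "AE x in \<Pi>\<^sub>M i\<in>{1..m}. unif. inj_on x {1..m} \<and> (\<forall>i\<in>{1..m}. 0 < x i \<and> x i < 1)"
    using AE_PiM_unif_inj[OF finite_atLeastAtMost, of 1 m]
      AE_PiM_unif_open[OF finite_atLeastAtMost, of 1 m] by (rule AE_conjI)
  hence W_inj: "AE \<omega> in M. inj_on (W \<omega>) {1..m} \<and> (\<forall>i\<in>{1..m}. 0 < W \<omega> i \<and> W \<omega> i < 1)"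
    by (rule AE_W)

  \<comment> \<open>No mass lies strictly below \<open>a\<close>, and the point \<open>a\<close> itself has no mass either.\<close>
  have F_lo: "F a = 0" if "lo = Some a" for a
  proof -
    have "AE \<omega> in M. Y 1 \<omega> \<noteq> a"
      using AE_distrD[OF Y[OF 1], of "\<lambda>y. y \<noteq> a"] AE_law_neq[of a] unfolding law[OF 1] by blast
    hence "AE \<omega> in M. \<not> Y 1 \<omega> \<le> a"
      using assms(7)[OF 1] by eventually_elim (auto simp: support_region_def that)
    hence "prob {\<omega> \<in> space M. Y 1 \<omega> \<le> a} = 0"
      using Y[OF 1] by (subst prob_eq_0) auto
    moreover have "F a = prob {\<omega> \<in> space M. Y 1 \<omega> \<le> a}"
      unfolding assms(6)[OF 1, symmetric] cdf_def using Y[OF 1]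
      by (subst measure_distr) (auto intro!: arg_cong[where f = prob])
    ultimately show ?thesis by simp
  qed
  have F_up: "F b = 1" if "up = Some b" for b
  proof -
    have "AE \<omega> in M. Y 1 \<omega> \<le> b"
      using assms(7)[OF 1] by eventually_elim (auto simp: support_region_def that)
    hence "prob {\<omega> \<in> space M. Y 1 \<omega> \<le> b} = 1"
      using Y[OF 1] by (subst prob_eq_1) auto
    moreover have "F b = prob {\<omega> \<in> space M. Y 1 \<omega> \<le> b}"
      unfolding assms(6)[OF 1, symmetric] cdf_def using Y[OF 1]
      by (subst measure_distr) (auto intro!: arg_cong[where f = prob])
    ultimately show ?thesis by simp
  qed

  \<comment> \<open>The vector \<open>F(X\<^sub>(\<^sub>0\<^sub>)), \<dots>, F(X\<^sub>(\<^sub>n\<^sub>+\<^sub>1\<^sub>))\<close>, expressed through the sorted uniform sample.\<close>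
  define E where "E \<omega> = pad (map_option (\<lambda>_. 0) lo) (map_option (\<lambda>_. 1) up) (ord_values {1..m} (W \<omega>))"
    for \<omega>
  have length_E: "length (E \<omega>) = n + 2" for \<omega>
    using n by (simp add: E_def length_pad)
  have FX: "F (X \<omega> i) = E \<omega> ! i" if i: "i \<le> n + 1" for \<omega> i
  proof -
    have "ord_values {1..m} (W \<omega>) = ord_values {1..m} (\<lambda>i. F (Y i \<omega>))"
      by (rule ord_values_cong) (simp add: W_def)
    also have "\<dots> = map F (ord_values {1..m} (\<lambda>i. Y i \<omega>))"
      using F_mono by (intro ord_values_mono) (auto intro: mono_on_subset)
    finally have "E \<omega> = map F (pad lo up (ord_values {1..m} (\<lambda>i. Y i \<omega>)))"
      using F_lo F_up by (auto simp: E_def pad_def split: option.splits)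
    moreover have "i < length (pad lo up (ord_values {1..m} (\<lambda>i. Y i \<omega>)))"
      using n i by (simp add: length_pad)
    ultimately show ?thesis by (simp add: X extended_order_stat_eq_pad)
  qed
  have sorted_E: "AE \<omega> in M. sorted_wrt (<) (E \<omega>)"
    using W_inj
  proof eventually_elim
    case (elim \<omega>)
    have "distinct (ord_values {1..m} (W \<omega>))"
      using elim by (intro card_distinct) (simp add: card_image)
    hence "sorted_wrt (<) (ord_values {1..m} (W \<omega>))"
      by (simp add: strict_sorted_iff)
    thus ?case using elim
      by (auto simp: E_def pad_def sorted_wrt_append split: option.splits)
  qed
  \<comment> \<open>All almost sure conclusions about \<open>X\<close> and \<open>U\<close> are consequences of this one event.\<close>
  have good: "AE \<omega> in M. strict_mono_on {0..n + 1} (X \<omega>) \<and>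
      strict_mono_on {0..n + 1} (\<lambda>i. F (X \<omega> i)) \<and>
      0 < F (X \<omega> (n + 1)) - F (X \<omega> 0) \<and>
      (\<forall>i\<le>n + 1. U \<omega> i = (F (X \<omega> i) - F (X \<omega> 0)) / (F (X \<omega> (n + 1)) - F (X \<omega> 0)))"
    using sorted_E
  proof eventually_elim
    case (elim \<omega>)
    have FX_mono: "F (X \<omega> i) < F (X \<omega> j)" if "i < j" "j \<le> n + 1" for i j
      using sorted_wrt_nth_less[OF elim that(1)] that by (simp add: FX length_E)
    have X_mono: "X \<omega> i < X \<omega> j" if "i < j" "j \<le> n + 1" for i j
      using FX_mono[OF that] F_mono by (meson leD leI monoD)
    have "U \<omega> i = (F (X \<omega> i) - F (X \<omega> 0)) / (F (X \<omega> (n + 1)) - F (X \<omega> 0))" if "i \<le> n + 1" for i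
    proof -
      have "X \<omega> 0 \<le> X \<omega> i" using X_mono[of 0 i] that by (cases "i = 0") auto
      moreover have "X \<omega> i \<le> X \<omega> (n + 1)" using X_mono[of i "n + 1"] that by (cases "i = n + 1") auto
      ultimately show ?thesis
        using X_mono[of 0 "n + 1"] by (simp add: U local_cdf_eq)
    qed
    thus ?case using X_mono FX_mono by (auto intro!: strict_mono_onI)
  qed

  have X_meas: "(\<lambda>\<omega>. X \<omega> i) \<in> borel_measurable M" if i: "i \<le> n + 1" for i
  proof -
    have Y': "(\<lambda>\<omega>. \<lambda>j\<in>{1..m}. Y j \<omega>) \<in> measurable M (\<Pi>\<^sub>M j\<in>{1..m}. borel)"
      by (intro measurable_restrict Y)
    have "(\<lambda>\<omega>. order_stat m (\<lambda>i. Y i \<omega>) j) \<in> borel_measurable M" if "j \<in> {1..m}" for j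
    proof -
      have "(\<lambda>\<omega>. ord_values {1..m} (\<lambda>i\<in>{1..m}. Y i \<omega>) ! (j - 1)) \<in> borel_measurable M"
        using that by (intro measurable_compose[OF Y' measurable_ord_values_nth]) auto
      moreover have "ord_values {1..m} (\<lambda>i\<in>{1..m}. Y i \<omega>) = ord_values {1..m} (\<lambda>i. Y i \<omega>)" for \<omega>
        by (rule ord_values_cong) simp
      ultimately show ?thesis by (simp add: order_stat_eq_ord_values)
    qed
    hence "(\<lambda>\<omega>. pad lo up (map (order_stat m (\<lambda>i. Y i \<omega>)) [1..<Suc m]) ! i) \<in> borel_measurable M"
      using i n by (intro measurable_pad_nth) (simp_all add: length_pad)
    thus ?thesis
      by (simp add: X extended_order_stat_def pad_def)
  qed
  have U_meas: "(\<lambda>\<omega>. \<lambda>i\<in>{1..n}. U \<omega> i) \<in> measurable M ?B"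
  proof (rule measurable_restrict)
    fix i assume "i \<in> {1..n}"
    hence [measurable]: "(\<lambda>\<omega>. X \<omega> i) \<in> borel_measurable M" "(\<lambda>\<omega>. X \<omega> 0) \<in> borel_measurable M"
      "(\<lambda>\<omega>. X \<omega> (n + 1)) \<in> borel_measurable M"
      by (auto intro: X_meas)
    show "(\<lambda>\<omega>. U \<omega> i) \<in> borel_measurable M"
      unfolding U local_cdf_eq by measurable
  qed

  have ordW: "(\<lambda>\<omega>. ord_vec {1..m} (W \<omega>)) \<in> measurable M (\<Pi>\<^sub>M i\<in>{1..m}. borel)"
    by (rule measurable_compose[OF W measurable_ord_vec]) auto
  have "distr M ?B (\<lambda>\<omega>. \<lambda>i\<in>{1..n}. U \<omega> i) =
      distr M ?B (spacing_ratios lo up m n \<circ> (\<lambda>\<omega>. ord_vec {1..m} (W \<omega>)))"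
  proof (rule distr_cong_AE)
    show "AE \<omega> in M. (\<lambda>i\<in>{1..n}. U \<omega> i) = (spacing_ratios lo up m n \<circ> (\<lambda>\<omega>. ord_vec {1..m} (W \<omega>))) \<omega>"
      using good
    proof eventually_elim
      case (elim \<omega>)
      have "map (ord_vec {1..m} (W \<omega>)) [1..<Suc m] = ord_values {1..m} (W \<omega>)"
        by (rule nth_equalityI) (auto simp: ord_vec_def)
      hence "spacing_ratios lo up m n (ord_vec {1..m} (W \<omega>)) =
          (\<lambda>i\<in>{1..n}. (E \<omega> ! i - E \<omega> ! 0) / (E \<omega> ! (n + 1) - E \<omega> ! 0))"
        by (simp add: spacing_ratios_def E_def Let_def)
      also have "\<dots> = (\<lambda>i\<in>{1..n}. U \<omega> i)"
        using elim by (intro restrict_ext) (simp add: FX)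
      finally show ?case by simp
    qed
  qed (use U_meas measurable_comp[OF ordW measurable_spacing_ratios[OF n]] in auto)
  also have "\<dots> = distr (distr M (\<Pi>\<^sub>M i\<in>{1..m}. borel) (\<lambda>\<omega>. ord_vec {1..m} (W \<omega>))) ?B
      (spacing_ratios lo up m n)"
    by (rule distr_distr[OF measurable_spacing_ratios[OF n] ordW, symmetric])
  also have "distr M (\<Pi>\<^sub>M i\<in>{1..m}. borel) (\<lambda>\<omega>. ord_vec {1..m} (W \<omega>)) =
      distr (distr M (\<Pi>\<^sub>M i\<in>{1..m}. borel) W) (\<Pi>\<^sub>M i\<in>{1..m}. borel) (ord_vec {1..m})"
    by (subst distr_distr[OF measurable_ord_vec W]) (auto simp: o_def)
  also have "\<dots> = ord_unif m"
    by (simp only: W_distr ord_unif_def)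
  also have "distr (ord_unif m) ?B (spacing_ratios lo up m n) = ord_unif n"
    by (rule distr_spacing_ratios_ord_unif[OF n])
  also have "ord_unif n = distr (\<Pi>\<^sub>M i\<in>{1..n}. unif) ?B (\<lambda>u. \<lambda>i\<in>{1..n}. order_stat n u i)"
    by (simp add: ord_unif_def ord_vec_def[abs_def] order_stat_eq_ord_values)
  finally have U_distr: "distr M ?B (\<lambda>\<omega>. \<lambda>i\<in>{1..n}. U \<omega> i) =
      distr (\<Pi>\<^sub>M i\<in>{1..n}. unif) ?B (\<lambda>u. \<lambda>i\<in>{1..n}. order_stat n u i)" .

  have U_ends: "AE \<omega> in M. U \<omega> 0 = 0 \<and> U \<omega> (n + 1) = 1"
    using good by eventually_elim auto
  have strict: "AE \<omega> in M. strict_mono_on {0..n + 1} (X \<omega>) \<and> strict_mono_on {0..n + 1} (U \<omega>)"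
    using good
  proof eventually_elim
    case (elim \<omega>)
    have "strict_mono_on {0..n + 1} (U \<omega>)"
    proof (rule strict_mono_onI)
      fix i j assume ij: "i \<in> {0..n + 1}" "j \<in> {0..n + 1}" "i < j"
      hence "F (X \<omega> i) < F (X \<omega> j)"
        using elim strict_mono_onD[of "{0..n + 1}" "\<lambda>i. F (X \<omega> i)" i j] by blast
      thus "U \<omega> i < U \<omega> j"
        using elim ij by (simp add: divide_strict_right_mono)
    qed
    thus ?case using elim by simp
  qed
  have comparison: "AE \<omega> in M. \<forall>j k. j < k \<and> k \<le> n + 1 \<and> k - j > 1 \<longrightarrow>
          (mono_on {X \<omega> j<..<X \<omega> k} f \<longrightarrow> T_stat j k (X \<omega>) \<ge> T_stat j k (U \<omega>))
        \<and> (antimono_on {X \<omega> j<..<X \<omega> k} f \<longrightarrow> T_stat j k (X \<omega>) \<le> T_stat j k (U \<omega>))"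
    using good
  proof eventually_elim
    case (elim \<omega>)
    thus ?case
      using T_stat_comparison[of "n + 1" "X \<omega>" "U \<omega>" "F (X \<omega> 0)" "F (X \<omega> (n + 1)) - F (X \<omega> 0)"]
      by blast
  qed
  show ?thesis
    using U_meas U_distr U_ends strict comparison by (intro conjI)
qed

end
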